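(* Let $m,n\ge 1$ be integers and let $T^h(m,n)$ be the number of horizontally excluded Catalan states in $\mathfrak{Cat}_{m,n}$. Then $$T^h(m,n)=\sum_{i=0}^{\infty}\left[\binom{2m+2n}{m-i(n+3)-2}-2\binom{2m+2n}{m-i(n+3)-3}+\binom{2m+2n}{m-i(n+3)-4}\right].$$
   Context: $P$ is a rectangle with $2(m+n)$ marked boundary points: $n$ on the top side and $n$ on the bottom side, and $m$ on the left side and $m$ on the right side (positions $1,\dots,m$ from top to bottom). A Catalan state is a crossingless connection of the marked points by $m+n$ disjoint arcs in $P$, up to isotopy fixing the boundary; equivalently a noncrossing perfect matching of the marked points. $\mathfrak{Cat}_{m,n}$ is the set of Catalan states. For $1\le i\le m-1$, $l_i^h$ is the horizontal line crossing $P$ between positions $i$ and $i+1$ on both the left and right sides. $\#(l_i^h\cap C)$ is the minimal number of intersections of $l_i^h$ with $C$ (up to isotopy), i.e. the number of arcs of $C$ whose endpoints lie on different sides of $l_i^h$. Define $d^h(C)=\max\{\#(l_i^h\cap C):1\le i\le m-1\}$ (equal to $0$ if $m=1$). A Catalan state $C$ is horizontally excluded if $d^h(C)>n$, and $T^h(m,n)=|\{C\in\mathfrak{Cat}_{m,n}: d^h(C)>n\}|$. Convention: $\binom{y}{z}=0$ when $z<0$ (so the sum is finite). *)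

theory Defs
  imports Complex_Main "HOL-Library.Disjoint_Sets"
begin

text \<open>Marked boundary points of the rectangle: \<open>Top j\<close> and \<open>Bottom j\<close> are numbered from left to
  right, \<open>Lft i\<close> and \<open>Rgt i\<close> from top to bottom; all numbering starts at 1.\<close>

datatype point = Top nat | Bottom nat | Lft nat | Rgt nat

definition marked_points :: "nat \<Rightarrow> nat \<Rightarrow> point set" where
  "marked_points m n = Top ` {1..n} \<union> Bottom ` {1..n} \<union> Lft ` {1..m} \<union> Rgt ` {1..m}"

text \<open>Rank of a marked point when the boundary is traversed clockwise from the top left corner:
  along the top, down the right side, back along the bottom, up the left side.\<close>

fun clockwise :: "nat \<Rightarrow> nat \<Rightarrow> point \<Rightarrow> nat" where
  "clockwise m n (Top j) = j"
| "clockwise m n (Rgt i) = n + i"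
| "clockwise m n (Bottom j) = n + m + (n + 1 - j)"
| "clockwise m n (Lft i) = n + m + n + (m + 1 - i)"

lemma bij_betw_clockwise:
  "bij_betw (clockwise m n) (marked_points m n) {1..2 * (m + n)}"
proof -
  have "inj_on (clockwise m n) (marked_points m n)"
    by (auto simp: inj_on_def marked_points_def)
  moreover have "clockwise m n ` marked_points m n = {1..2 * (m + n)}"
  proof
    show "clockwise m n ` marked_points m n \<subseteq> {1..2 * (m + n)}"
      by (auto simp: marked_points_def image_iff)
    show "{1..2 * (m + n)} \<subseteq> clockwise m n ` marked_points m n"
    proof
      fix k assume k: "k \<in> {1..2 * (m + n)}"
      consider "k \<le> n" | "n < k" "k \<le> n + m" | "n + m < k" "k \<le> n + m + n" | "n + m + n < k"
        by linarith
      then have "\<exists>p \<in> marked_points m n. k = clockwise m n p"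
      proof cases
        case 1
        then show ?thesis
          using k by (intro bexI[of _ "Top k"]) (auto simp: marked_points_def image_iff)
      next
        case 2
        then show ?thesis
          by (intro bexI[of _ "Rgt (k - n)"]) (auto simp: marked_points_def image_iff)
      next
        case 3
        then show ?thesis
          by (intro bexI[of _ "Bottom (n + 1 - (k - (n + m)))"]) (auto simp: marked_points_def image_iff)
      next
        case 4
        then show ?thesis
          using k by (intro bexI[of _ "Lft (m + 1 - (k - (n + m + n)))"])
            (auto simp: marked_points_def image_iff)
      qed
      then show "k \<in> clockwise m n ` marked_points m n" by blast
    qed
  qed
  ultimately show ?thesis by (simp add: bij_betw_def)
qed

text \<open>An arc is represented by the set of its two endpoints, and a crossingless connection, which is
  determined up to isotopy fixing the boundary by the pairs of points it joins, by the set of its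
  arcs.\<close>

definition perfect_matching :: "'a set \<Rightarrow> 'a set set \<Rightarrow> bool" where
  "perfect_matching A C \<longleftrightarrow> partition_on A C \<and> (\<forall>a \<in> C. card a = 2)"

definition noncrossing :: "nat \<Rightarrow> nat \<Rightarrow> point set set \<Rightarrow> bool" where
  "noncrossing m n C \<longleftrightarrow>
     \<not> (\<exists>p q r s. {p, q} \<in> C \<and> {r, s} \<in> C \<and>
          clockwise m n p < clockwise m n r \<and>
          clockwise m n r < clockwise m n q \<and>
          clockwise m n q < clockwise m n s)"

definition catalan_states :: "nat \<Rightarrow> nat \<Rightarrow> point set set set" where
  "catalan_states m n = {C. perfect_matching (marked_points m n) C \<and> noncrossing m n C}"

lemma finite_catalan_states: "finite (catalan_states m n)"
proof (rule finite_subset)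
  show "catalan_states m n \<subseteq> Pow (Pow (marked_points m n))"
    by (auto simp: catalan_states_def perfect_matching_def partition_on_def)
qed (simp add: marked_points_def)

text \<open>\<open>above_line i p\<close>: the point \<open>p\<close> lies above the horizontal line that passes between positions
  \<open>i\<close> and \<open>i + 1\<close> on the left and right sides.\<close>

fun above_line :: "nat \<Rightarrow> point \<Rightarrow> bool" where
  "above_line i (Top _) \<longleftrightarrow> True"
| "above_line i (Bottom _) \<longleftrightarrow> False"
| "above_line i (Lft k) \<longleftrightarrow> k \<le> i"
| "above_line i (Rgt k) \<longleftrightarrow> k \<le> i"

definition line_crossings :: "nat \<Rightarrow> point set set \<Rightarrow> nat" where
  "line_crossings i C = card {a \<in> C. \<exists>p \<in> a. \<exists>q \<in> a. above_line i p \<and> \<not> above_line i q}"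

definition d_h :: "nat \<Rightarrow> point set set \<Rightarrow> nat" where
  "d_h m C = (if m \<le> 1 then 0 else Max ((\<lambda>i. line_crossings i C) ` {1..m - 1}))"

definition horizontally_excluded :: "nat \<Rightarrow> nat \<Rightarrow> point set set \<Rightarrow> bool" where
  "horizontally_excluded m n C \<longleftrightarrow> d_h m C > n"

definition T_h :: "nat \<Rightarrow> nat \<Rightarrow> nat" where
  "T_h m n = card {C \<in> catalan_states m n. horizontally_excluded m n C}"

text \<open>Binomial coefficient with an integer lower index, zero when that index is negative.\<close>

definition binom :: "nat \<Rightarrow> int \<Rightarrow> int" where
  "binom y z = (if z < 0 then 0 else int (y choose nat z))"

end

theory Submission
  imports Defs
begin

text \<open>Add the marked points one at a time: the top side, then \<open>Rgt 1\<close>, \<open>Lft 1\<close>, \<open>Rgt 2\<close>,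
  \<open>Lft 2\<close>, and so on, then the bottom side from right to left. In the boundary cut open at its
  lower left corner every new point is leftmost or rightmost, so it either stays unmatched for the
  moment or is joined to the nearest unmatched point. Hence a Catalan state is determined by the
  number of points still unmatched after each step, and these numbers form an arbitrary Dyck path of
  length \<open>2 * (m + n)\<close>. Its height after \<open>n + 2 * i\<close> steps is the number of crossings with the
  \<open>i\<close>-th horizontal line, so by parity the horizontally excluded states correspond to the Dyck
  paths of height at least \<open>n + 2\<close>, which the reflection principle counts.\<close>

section \<open>Partial noncrossing matchings\<close>

text \<open>Symmetric in the endpoints, because an arc is an unordered pair
  \<open>{a, b}\<close>.\<close>

definition btw :: "'b::linorder \<Rightarrow> 'b \<Rightarrow> 'b \<Rightarrow> bool" where
  "btw a z b \<longleftrightarrow> a < z \<and> z < b \<or> b < z \<and> z < a"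

text \<open>The last condition says both that arcs do not cross and that no arc encloses an unmatched
  point.\<close>

definition partial_noncrossing :: "('a \<Rightarrow> 'b::linorder) \<Rightarrow> 'a set \<Rightarrow> 'a set set \<Rightarrow> bool" where
  "partial_noncrossing key S M \<longleftrightarrow>
     (\<forall>A\<in>M. A \<subseteq> S \<and> card A = 2) \<and> disjoint M \<and>
     (\<forall>a b z. {a, b} \<in> M \<longrightarrow> z \<in> S \<longrightarrow> btw (key a) (key z) (key b) \<longrightarrow>
        (\<exists>w. {z, w} \<in> M \<and> btw (key a) (key w) (key b)))"

definition extremal :: "('a \<Rightarrow> 'b::linorder) \<Rightarrow> 'a set \<Rightarrow> 'a \<Rightarrow> bool" where
  "extremal key S x \<longleftrightarrow> (\<forall>s\<in>S. key s < key x) \<or> (\<forall>s\<in>S. key x < key s)"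

text \<open>The candidate partner of a new point \<open>x\<close>: joining \<open>x\<close> to any
  other point of \<open>U\<close> would enclose an unmatched one.\<close>

definition nearest :: "('a \<Rightarrow> 'b::linorder) \<Rightarrow> 'a set \<Rightarrow> 'a \<Rightarrow> 'a \<Rightarrow> bool" where
  "nearest key U x u \<longleftrightarrow> u \<in> U \<and> (\<forall>z\<in>U. \<not> btw (key u) (key z) (key x))"

lemma extremal_subset: "extremal key S x \<Longrightarrow> U \<subseteq> S \<Longrightarrow> extremal key U x"
  by (auto simp: extremal_def)

lemma extremal_not_mem: "extremal key S x \<Longrightarrow> x \<notin> S"
  by (auto simp: extremal_def)

lemma extremal_not_btw: "extremal key S x \<Longrightarrow> a \<in> S \<Longrightarrow> b \<in> S \<Longrightarrow> \<not> btw (key a) (key x) (key b)"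
  by (auto simp: extremal_def btw_def)

text \<open>If \<open>x\<close> lies to the right of \<open>U\<close>, the point with the largest
  key works; if it lies to the left, the one with the smallest.\<close>

lemma nearest_exists:
  assumes "finite U" "U \<noteq> {}" "extremal key U x"
  shows "\<exists>u. nearest key U x u"
proof -
  have fin: "finite (key ` U)" "key ` U \<noteq> {}"
    using assms by auto
  obtain u v where u: "u \<in> U" "key u = Max (key ` U)" and v: "v \<in> U" "key v = Min (key ` U)"
    using Max_in[OF fin] Min_in[OF fin] by (metis imageE)
  have "key z \<le> key u" "key v \<le> key z" if "z \<in> U" for z
    using that u v fin by simp_all
  then show ?thesis
    using assms(3) u(1) v(1) unfolding extremal_def nearest_def btw_def
    by (metis less_asym not_less)
qed

lemma nearest_unique:
  assumes "inj_on key U" "extremal key U x" "nearest key U x u" "nearest key U x v"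
  shows "u = v"
proof -
  have "key u = key v"
    using assms(2-4) unfolding extremal_def nearest_def btw_def by (metis linorder_less_linear)
  then show ?thesis
    using assms by (auto simp: nearest_def inj_on_def)
qed

lemma disjointD_mem: "disjoint M \<Longrightarrow> A \<in> M \<Longrightarrow> B \<in> M \<Longrightarrow> x \<in> A \<Longrightarrow> x \<in> B \<Longrightarrow> A = B"
  by (metis disjointD disjoint_iff)

lemma card_2_memE:
  assumes "card A = 2" "x \<in> A"
  obtains u where "A = {u, x}" "u \<noteq> x"
  using assms by (auto simp: card_2_iff)

text \<open>No arc inside \<open>S\<close> can enclose an extremal point, so leaving
  \<open>x\<close> unmatched never violates the nesting condition.\<close>

lemma partial_noncrossing_insert_free:
  assumes "extremal key S x"
  shows "partial_noncrossing key (insert x S) M \<and> x \<notin> \<Union>M \<longleftrightarrow> partial_noncrossing key S M"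
    (is "?l \<longleftrightarrow> ?r")
proof
  assume l: ?l
  then have "\<forall>A\<in>M. A \<subseteq> S \<and> card A = 2"
    unfolding partial_noncrossing_def by blast
  with l show ?r
    unfolding partial_noncrossing_def by blast
next
  assume r: ?r
  then have sub: "\<forall>A\<in>M. A \<subseteq> S \<and> card A = 2"
    unfolding partial_noncrossing_def by blast
  then have "\<not> btw (key a) (key x) (key b)" if "{a, b} \<in> M" for a b
    using extremal_not_btw[OF assms, of a b] sub that by auto
  with r sub extremal_not_mem[OF assms] show ?l
    unfolding partial_noncrossing_def by blast
qed

text \<open>Undoes the joining of \<open>x\<close>. A point enclosed by the removed arc has its
  partner enclosed as well, hence is still matched in \<open>R\<close>; so the old partner
  \<open>u\<close> was the nearest unmatched point.\<close>

lemma partial_noncrossing_delete: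
  assumes x: "extremal key S x" and M: "partial_noncrossing key (insert x S) M" and "x \<in> \<Union>M"
  defines "R \<equiv> {A \<in> M. x \<notin> A}"
  shows "\<exists>u. M = insert {u, x} R \<and> partial_noncrossing key S R \<and> nearest key (S - \<Union>R) x u"
proof -
  have sub: "\<forall>A\<in>M. A \<subseteq> insert x S \<and> card A = 2" and disj: "disjoint M"
    and nc: "\<And>a b z. {a, b} \<in> M \<Longrightarrow> z \<in> insert x S \<Longrightarrow> btw (key a) (key z) (key b) \<Longrightarrow>
        \<exists>w. {z, w} \<in> M \<and> btw (key a) (key w) (key b)"
    using M unfolding partial_noncrossing_def by blast+
  obtain u where u: "{u, x} \<in> M" "u \<noteq> x"
    using \<open>x \<in> \<Union>M\<close> sub by (metis UnionE card_2_memE)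
  have M_eq: "M = insert {u, x} R"
    using disjointD_mem[OF disj u(1), of _ x] u(1) unfolding R_def by blast
  have subR: "\<forall>A\<in>R. A \<subseteq> S \<and> card A = 2"
    using sub unfolding R_def by blast
  have uS: "u \<in> S"
    using sub u by blast
  have uR: "u \<notin> \<Union>R"
    using disjointD_mem[OF disj u(1), of _ u] unfolding R_def by blast
  have "disjoint R"
    using disj unfolding R_def disjoint_def by blast
  moreover have "\<exists>w. {z, w} \<in> R \<and> btw (key a) (key w) (key b)"
    if R: "{a, b} \<in> R" "z \<in> S" "btw (key a) (key z) (key b)" for a b z
  proof -
    obtain w where w: "{z, w} \<in> M" "btw (key a) (key w) (key b)"
      using nc[of a b z] R unfolding R_def by blast
    have "w \<noteq> x"
      using extremal_not_btw[OF x, of a b] w subR R by blast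
    then show ?thesis
      using w R extremal_not_mem[OF x] unfolding R_def by blast
  qed
  moreover have "\<not> btw (key u) (key z) (key x)" if R: "z \<in> S - \<Union>R" for z
  proof
    assume btw: "btw (key u) (key z) (key x)"
    then obtain w where "{z, w} \<in> M" "btw (key u) (key w) (key x)"
      using nc[OF u(1)] R by blast
    then have "{z, w} \<in> R"
      using R extremal_not_mem[OF x] unfolding R_def btw_def by blast
    then show False
      using R by blast
  qed
  ultimately show ?thesis
    using M_eq subR uS uR unfolding partial_noncrossing_def nearest_def by blast
qed

text \<open>Since \<open>u\<close> is nearest, all points between \<open>u\<close> and
  \<open>x\<close> are already matched. Their partners lie there too, as an arc leaving this range
  would enclose the unmatched \<open>u\<close> or pass the extremal \<open>x\<close>.\<close>

lemma partial_noncrossing_insert_arc: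
  assumes x: "extremal key S x" and inj: "inj_on key S"
    and M: "partial_noncrossing key S M" and u: "nearest key (S - \<Union>M) x u"
  shows "partial_noncrossing key (insert x S) (insert {u, x} M)"
proof -
  have sub: "\<forall>A\<in>M. A \<subseteq> S \<and> card A = 2" and disj: "disjoint M"
    and nc: "\<And>a b z. {a, b} \<in> M \<Longrightarrow> z \<in> S \<Longrightarrow> btw (key a) (key z) (key b) \<Longrightarrow>
        \<exists>w. {z, w} \<in> M \<and> btw (key a) (key w) (key b)"
    using M unfolding partial_noncrossing_def by blast+
  have uS: "u \<in> S" "u \<notin> \<Union>M"
    using u by (auto simp: nearest_def)
  have xM: "x \<notin> S" "x \<notin> \<Union>M" "u \<noteq> x"
    using sub extremal_not_mem[OF x] uS by auto
  have "\<forall>A\<in>insert {u, x} M. A \<subseteq> insert x S \<and> card A = 2"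
    using sub uS xM by auto
  moreover have "disjoint (insert {u, x} M)"
    using disj uS xM unfolding disjoint_def by blast
  moreover have "\<exists>w. {z, w} \<in> insert {u, x} M \<and> btw (key a) (key w) (key b)"
    if arc: "{a, b} \<in> insert {u, x} M" and z: "z \<in> insert x S" "btw (key a) (key z) (key b)" for a b z
  proof (cases "{a, b} \<in> M")
    case True
    then have "z \<noteq> x"
      using extremal_not_btw[OF x, of a b] sub z by blast
    then show ?thesis
      using nc[OF True] z by blast
  next
    case False
    with arc have ab: "a = u \<and> b = x \<or> a = x \<and> b = u"
      by (auto simp: doubleton_eq_iff)
    have zux: "btw (key u) (key z) (key x)"
      using z(2) ab by (auto simp: btw_def)
    then have zS: "z \<in> S"
      using z(1) by (auto simp: btw_def)
    then have "z \<in> \<Union>M"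
      using u zux by (auto simp: nearest_def)
    then obtain A where "A \<in> M" "z \<in> A" by blast
    then obtain w where w: "{w, z} \<in> M" "w \<noteq> z"
      using sub by (metis card_2_memE)
    have wS: "w \<in> S" "w \<noteq> u"
      using w sub uS by auto
    \<comment> \<open>If the arc \<open>{w, z}\<close> enclosed \<open>u\<close>, then
      \<open>u\<close> would be matched in \<open>M\<close>.\<close>
    have "\<not> btw (key w) (key u) (key z)"
      using nc[OF w(1) uS(1)] uS(2) by blast
    moreover have "key w \<noteq> key u"
      using wS inj uS by (auto simp: inj_on_def)
    ultimately have "btw (key u) (key w) (key x)"
      using zux x wS zS uS unfolding extremal_def btw_def by (metis less_trans linorder_less_linear less_asym)
    then show ?thesis
      using w ab by (auto simp: insert_commute btw_def)
  qed
  ultimately show ?thesis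
    unfolding partial_noncrossing_def by blast
qed

section \<open>Counting by the profile of defects\<close>

definition inner_arcs :: "'a set \<Rightarrow> 'a set set \<Rightarrow> 'a set set" where
  "inner_arcs S M = {A \<in> M. A \<subseteq> S}"

text \<open>An arc with just one endpoint in \<open>S\<close> leaves that endpoint unmatched, so the
  heights of all prefixes can be read off the completed matching.\<close>

definition defect :: "'a set \<Rightarrow> 'a set set \<Rightarrow> nat" where
  "defect S M = card (S - \<Union>(inner_arcs S M))"

lemma inner_arcs_partial: "partial_noncrossing key S M \<Longrightarrow> inner_arcs S M = M"
  by (auto simp: inner_arcs_def partial_noncrossing_def)

lemma card_Union_pairs:
  assumes "finite S" "\<forall>A\<in>M. A \<subseteq> S \<and> card A = 2" "disjoint M"
  shows "card (\<Union>M) = 2 * card M"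
proof -
  have "card (\<Union>M) = sum card M"
    using assms by (intro card_Union_disjoint) (auto simp: disjoint_def pairwise_def disjnt_def intro: finite_subset)
  also have "\<dots> = 2 * card M"
    using assms(2) by simp
  finally show ?thesis .
qed

text \<open>Every arc inside \<open>S\<close> uses up two of its points; in particular the defect
  has the parity of \<open>card S\<close>.\<close>

lemma defect_plus_arcs:
  assumes "finite S" "\<forall>A\<in>M. card A = 2" "disjoint M"
  shows "defect S M + 2 * card (inner_arcs S M) = card S"
proof -
  have "card (\<Union>(inner_arcs S M)) = 2 * card (inner_arcs S M)"
    using assms by (intro card_Union_pairs[of S]) (auto simp: inner_arcs_def disjoint_def)
  moreover have sub: "\<Union>(inner_arcs S M) \<subseteq> S"
    by (auto simp: inner_arcs_def)
  ultimately show ?thesis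
    using assms(1) card_mono[OF assms(1) sub] unfolding defect_def
    by (subst card_Diff_subset) (auto intro: finite_subset)
qed

text \<open>By disjointness at most one arc contains \<open>x\<close>, and only that arc can become
  an inner one.\<close>

lemma card_inner_arcs_insert:
  assumes "finite S" "\<forall>A\<in>M. card A = 2" "disjoint M"
  shows "card (inner_arcs S M) \<le> card (inner_arcs (insert x S) M)"
    and "card (inner_arcs (insert x S) M) \<le> card (inner_arcs S M) + 1"
proof -
  have fin: "finite (inner_arcs T M)" if "finite T" for T
    using that by (auto simp: inner_arcs_def intro: finite_subset[of _ "Pow T"])
  show "card (inner_arcs S M) \<le> card (inner_arcs (insert x S) M)"
    using fin[of "insert x S"] assms(1) by (intro card_mono) (auto simp: inner_arcs_def)
  show "card (inner_arcs (insert x S) M) \<le> card (inner_arcs S M) + 1"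
  proof (cases "\<exists>B\<in>M. x \<in> B")
    case True
    then obtain B where B: "B \<in> M" "x \<in> B" by blast
    have "A = B" if "A \<in> M" "x \<in> A" for A
      using disjointD_mem[OF assms(3) that(1) B(1) that(2) B(2)] .
    then have "inner_arcs (insert x S) M \<subseteq> insert B (inner_arcs S M)"
      by (auto simp: inner_arcs_def)
    then have "card (inner_arcs (insert x S) M) \<le> card (insert B (inner_arcs S M))"
      using fin[OF assms(1)] by (intro card_mono) auto
    also have "\<dots> \<le> card (inner_arcs S M) + 1"
      using fin[OF assms(1)] by (simp add: card_insert_if)
    finally show ?thesis .
  next
    case False
    then have "inner_arcs (insert x S) M = inner_arcs S M"
      by (auto simp: inner_arcs_def)
    then show ?thesis by simp
  qed
qed

section \<open>Recursion for matchings with heights bounded by \<open>B\<close>\<close>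

text \<open>Two orders are in play: \<open>p\<close> lists the points as they are added, while
  \<open>key\<close> orders them along the cut boundary.\<close>

locale extremal_enumeration =
  fixes p :: "nat \<Rightarrow> 'a" and key :: "'a \<Rightarrow> 'b::linorder" and N :: nat
  assumes extremal_p: "k < N \<Longrightarrow> extremal key (p ` {..<k}) (p k)"
begin

abbreviation S :: "nat \<Rightarrow> 'a set" where
  "S k \<equiv> p ` {..<k}"

lemma S_Suc: "S (Suc k) = insert (p k) (S k)"
  by (simp add: lessThan_Suc)

lemma key_p_neq:
  assumes "j < k" "k < N"
  shows "key (p j) \<noteq> key (p k)"
  using extremal_p[OF assms(2)] assms(1) unfolding extremal_def by (metis imageI lessThan_iff less_irrefl)

lemma inj_on_key_p: "inj_on (\<lambda>k. key (p k)) {..<N}"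
  using key_p_neq by (auto simp: inj_on_def) (metis linorder_less_linear)

lemma inj_on_key: "k \<le> N \<Longrightarrow> inj_on key (S k)"
  using inj_on_key_p unfolding inj_on_def by fastforce

lemma inj_on_p: "inj_on p {..<N}"
  using inj_on_key_p unfolding inj_on_def by fastforce

lemma p_notin: "j \<le> k \<Longrightarrow> k < N \<Longrightarrow> p k \<notin> S j"
  using extremal_not_mem[OF extremal_p[of k]] by auto

lemma card_S: "k \<le> N \<Longrightarrow> card (S k) = k"
  using inj_on_p by (simp add: card_image inj_on_subset)

lemma defect_Suc:
  assumes "k < N" "\<forall>A\<in>M. card A = 2" "disjoint M"
  shows "defect (S (Suc k)) M \<le> defect (S k) M + 1" "defect (S k) M \<le> defect (S (Suc k)) M + 1"
  using defect_plus_arcs[of "S k" M] defect_plus_arcs[of "S (Suc k)" M]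
    card_inner_arcs_insert[of "S k" M "p k"] card_S[of k] card_S[of "Suc k"] assms
  by (simp_all add: S_Suc[symmetric])

text \<open>Heights drop by at most one per step. With final height 0 this bounds a height by the
  number of remaining steps.\<close>

lemma defect_diff:
  assumes "j \<le> k" "k \<le> N" "\<forall>A\<in>M. card A = 2" "disjoint M"
  shows "defect (S j) M \<le> defect (S k) M + (k - j)"
  using assms(1,2)
proof (induction k rule: dec_induct)
  case (step k)
  then show ?case
    using defect_Suc(2)[of k M] assms(3,4) by simp
qed simp

definition bounded_states :: "nat \<Rightarrow> nat \<Rightarrow> nat \<Rightarrow> 'a set set set" where
  "bounded_states B k h = {M. partial_noncrossing key (S k) M \<and> defect (S k) M = h \<and>
     (\<forall>j\<le>k. defect (S j) M \<le> B)}"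

lemma finite_bounded_states: "finite (bounded_states B k h)"
  by (rule finite_subset[of _ "Pow (Pow (S k))"])
    (auto simp: bounded_states_def partial_noncrossing_def)

lemma bounded_states_0: "bounded_states B 0 h = (if h = 0 then {{}} else {})"
  by (auto simp: bounded_states_def partial_noncrossing_def defect_def disjoint_def)

lemma bounded_states_gt: "B < h \<Longrightarrow> bounded_states B k h = {}"
  by (auto simp: bounded_states_def)

text \<open>An up step: the matching itself does not change, which is why the two sets are equal and
  not merely equinumerous.\<close>

lemma bounded_states_Suc_free:
  assumes "k < N" "h \<le> B"
  shows "{M \<in> bounded_states B (Suc k) h. p k \<notin> \<Union>M} = (if h = 0 then {} else bounded_states B k (h - 1))"
proof -
  have eq: "partial_noncrossing key (S (Suc k)) M \<and> p k \<notin> \<Union>M \<longleftrightarrow> partial_noncrossing key (S k) M" for M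
    using partial_noncrossing_insert_free[OF extremal_p[OF assms(1)]] by (simp add: S_Suc)
  have defect: "defect (S (Suc k)) M = Suc (defect (S k) M)" if "partial_noncrossing key (S k) M" for M
  proof -
    from eq that have "partial_noncrossing key (S (Suc k)) M" "p k \<notin> \<Union>M" by auto
    then have "S (Suc k) - \<Union>(inner_arcs (S (Suc k)) M) = insert (p k) (S k - \<Union>(inner_arcs (S k) M))"
      using that by (simp add: inner_arcs_partial S_Suc insert_Diff_if)
    then show ?thesis
      using p_notin[of k k] assms(1) by (simp add: defect_def)
  qed
  show ?thesis
  proof (rule set_eqI)
    fix M
    have all: "(\<forall>j\<le>Suc k. defect (S j) M \<le> B) \<longleftrightarrow>
        (\<forall>j\<le>k. defect (S j) M \<le> B) \<and> defect (S (Suc k)) M \<le> B"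
      using le_Suc_eq by blast
    show "M \<in> {M \<in> bounded_states B (Suc k) h. p k \<notin> \<Union>M} \<longleftrightarrow>
        M \<in> (if h = 0 then {} else bounded_states B k (h - 1))"
    proof (cases "partial_noncrossing key (S k) M")
      case True
      then have "partial_noncrossing key (S (Suc k)) M" "p k \<notin> \<Union>M"
        using eq by blast+
      with True all defect[OF True] assms(2) show ?thesis
        unfolding bounded_states_def mem_Collect_eq by (cases h) auto
    next
      case False
      then have "\<not> (partial_noncrossing key (S (Suc k)) M \<and> p k \<notin> \<Union>M)"
        using eq by blast
      with False show ?thesis
        unfolding bounded_states_def by auto
    qed
  qed
qed

text \<open>A down step: deleting the arc at \<open>p k\<close> is a bijection. It is injective
  because the partner must be the nearest unmatched point, and surjective because at height
  \<open>Suc h\<close> such a point exists.\<close>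

lemma bounded_states_Suc_arc:
  assumes k: "k < N" and h: "h \<le> B"
  shows "card {M \<in> bounded_states B (Suc k) h. p k \<in> \<Union>M} = card (bounded_states B k (Suc h))"
proof -
  note ext = extremal_p[OF k]
  define r where "r M = {A \<in> M. p k \<notin> A}" for M
  let ?X = "{M \<in> bounded_states B (Suc k) h. p k \<in> \<Union>M}"
  \<comment> \<open>The deleted arc contains \<open>p k\<close> and so lies in no earlier prefix;
    the earlier heights are unaffected.\<close>
  have inner: "inner_arcs (S j) (r M) = inner_arcs (S j) M" if "j \<le> k" for j M
    using p_notin[OF that k] unfolding inner_arcs_def r_def by blast
  have defect_r: "defect (S j) (r M) = defect (S j) M" if "j \<le> k" for j M
    using inner[OF that] by (simp add: defect_def)
  have step: "defect (S k) M = Suc (defect (S (Suc k)) (insert {u, p k} M))"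
    if M: "partial_noncrossing key (S k) M" and u: "nearest key (S k - \<Union>M) (p k) u" for M u
  proof -
    have "partial_noncrossing key (S (Suc k)) (insert {u, p k} M)"
      using partial_noncrossing_insert_arc[OF ext inj_on_key M u] k by (simp add: S_Suc)
    then have "S (Suc k) - \<Union>(inner_arcs (S (Suc k)) (insert {u, p k} M)) = (S k - \<Union>M) - {u}"
      using p_notin[of k k] k unfolding S_Suc by (subst inner_arcs_partial) blast+
    moreover have "card (S k - \<Union>M) = Suc (card ((S k - \<Union>M) - {u}))"
      using u by (intro card.remove) (auto simp: nearest_def)
    ultimately show ?thesis
      using M by (simp add: defect_def inner_arcs_partial)
  qed
  have destr: "\<exists>u. M = insert {u, p k} (r M) \<and> partial_noncrossing key (S k) (r M) \<and>
      nearest key (S k - \<Union>(r M)) (p k) u" if "M \<in> ?X" for M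
    using partial_noncrossing_delete[OF ext, of M] that
    unfolding r_def bounded_states_def S_Suc by simp
  have "inj_on r ?X"
  proof (rule inj_onI)
    fix M M' assume M: "M \<in> ?X" "M' \<in> ?X" and eq: "r M = r M'"
    obtain u where u: "M = insert {u, p k} (r M)" "nearest key (S k - \<Union>(r M)) (p k) u"
      using destr[OF M(1)] by blast
    obtain u' where u': "M' = insert {u', p k} (r M')" "nearest key (S k - \<Union>(r M')) (p k) u'"
      using destr[OF M(2)] by blast
    have "inj_on key (S k - \<Union>(r M))" "extremal key (S k - \<Union>(r M)) (p k)"
      using inj_on_key[of k] k extremal_subset[OF ext, of "S k - \<Union>(r M)"]
      by (auto intro: inj_on_subset)
    then have "u = u'"
      using nearest_unique u u' eq by metis
    then show "M = M'"
      using u u' eq by metis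
  qed
  moreover have "r ` ?X = bounded_states B k (Suc h)"
  proof
    show "r ` ?X \<subseteq> bounded_states B k (Suc h)"
    proof (rule image_subsetI)
      fix M assume M: "M \<in> ?X"
      obtain u where u: "M = insert {u, p k} (r M)" "partial_noncrossing key (S k) (r M)"
          "nearest key (S k - \<Union>(r M)) (p k) u"
        using destr[OF M] by blast
      have "defect (S k) (r M) = Suc h"
        using step[OF u(2,3)] u(1) M by (simp add: bounded_states_def)
      then show "r M \<in> bounded_states B k (Suc h)"
        using M u(2) by (simp add: bounded_states_def defect_r)
    qed
    show "bounded_states B k (Suc h) \<subseteq> r ` ?X"
    proof
      fix M assume M: "M \<in> bounded_states B k (Suc h)"
      then have pn: "partial_noncrossing key (S k) M" and "defect (S k) M = Suc h"
        by (auto simp: bounded_states_def)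
      then have "S k - \<Union>M \<noteq> {}"
        by (metis Zero_not_Suc card.empty defect_def inner_arcs_partial)
      then obtain u where u: "nearest key (S k - \<Union>M) (p k) u"
        using nearest_exists[of "S k - \<Union>M" key "p k"] extremal_subset[OF ext, of "S k - \<Union>M"] by blast
      define M' where "M' = insert {u, p k} M"
      have rM': "r M' = M"
        using pn p_notin[of k k] k unfolding M'_def r_def partial_noncrossing_def by blast
      have "partial_noncrossing key (S (Suc k)) M'"
        using partial_noncrossing_insert_arc[OF ext inj_on_key pn u] k by (simp add: S_Suc M'_def)
      moreover have "defect (S (Suc k)) M' = h"
        using step[OF pn u] M by (simp add: M'_def bounded_states_def)
      moreover have "defect (S j) M' \<le> B" if "j \<le> k" for j
      proof -
        have "defect (S j) M \<le> B"
          using M that unfolding bounded_states_def by blast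
        then show ?thesis
          using defect_r[OF that, of M'] unfolding rM' by simp
      qed
      ultimately have "M' \<in> ?X"
        using h by (auto simp: bounded_states_def le_Suc_eq M'_def)
      then show "M \<in> r ` ?X"
        using rM' by blast
    qed
  qed
  ultimately show ?thesis
    by (metis card_image)
qed

lemma card_bounded_states_Suc:
  assumes "k < N" "h \<le> B"
  shows "card (bounded_states B (Suc k) h) =
    (if h = 0 then 0 else card (bounded_states B k (h - 1))) + card (bounded_states B k (Suc h))"
proof -
  let ?W = "bounded_states B (Suc k) h"
  have "card ({M \<in> ?W. p k \<notin> \<Union>M} \<union> {M \<in> ?W. p k \<in> \<Union>M}) =
      card {M \<in> ?W. p k \<notin> \<Union>M} + card {M \<in> ?W. p k \<in> \<Union>M}"
    using finite_bounded_states[of B "Suc k" h] by (intro card_Un_disjoint) auto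
  moreover have "{M \<in> ?W. p k \<notin> \<Union>M} \<union> {M \<in> ?W. p k \<in> \<Union>M} = ?W"
    by blast
  ultimately show ?thesis
    unfolding bounded_states_Suc_free[OF assms] bounded_states_Suc_arc[OF assms] by simp
qed

end

section \<open>Walks and the reflection principle\<close>

text \<open>The number of unrestricted walks of \<open>k\<close> steps +1 or -1 from 0 to
  \<open>x\<close>.\<close>

fun walks :: "nat \<Rightarrow> int \<Rightarrow> int" where
  "walks 0 x = (if x = 0 then 1 else 0)"
| "walks (Suc k) x = walks k (x - 1) + walks k (x + 1)"

lemma walks_minus: "walks k (- x) = walks k x"
proof (induction k arbitrary: x)
  case (Suc k)
  have "- x - 1 = - (x + 1)" "- x + 1 = - (x - 1)"
    by simp_all
  then show ?case
    by (simp only: walks.simps Suc.IH add.commute)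
qed simp

lemma walks_eq_0: "int k < \<bar>x\<bar> \<Longrightarrow> walks k x = 0"
  by (induction k arbitrary: x) auto

lemma binom_Suc: "binom (Suc k) y = binom k (y - 1) + binom k y"
proof (cases "y \<le> 0")
  case False
  then have "nat y = Suc (nat (y - 1))" by simp
  then show ?thesis
    using False by (simp add: binom_def)
qed (auto simp: binom_def)

text \<open>\<open>y\<close> up steps among \<open>k\<close> steps end at
  \<open>y - (k - y)\<close>.\<close>

lemma walks_eq_binom: "walks k (2 * y - int k) = binom k y"
proof (induction k arbitrary: y)
  case 0
  show ?case by (auto simp: binom_def)
next
  case (Suc k)
  have "walks (Suc k) (2 * y - int (Suc k)) = walks k (2 * (y - 1) - int k) + walks k (2 * y - int k)"
    by (simp add: algebra_simps)
  then show ?case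
    by (simp only: Suc.IH binom_Suc)
qed

text \<open>Walks from 0 to \<open>x\<close> that avoid \<open>-1\<close> and \<open>P - 1\<close>; the sum over all reflections is cut off
  at \<open>J\<close>, which loses nothing when \<open>k \<le> J\<close>.\<close>

definition reflected_walks :: "int \<Rightarrow> int \<Rightarrow> nat \<Rightarrow> int \<Rightarrow> int" where
  "reflected_walks P J k x =
     (\<Sum>j\<in>{-J..J}. walks k (x + 2 * j * P) - walks k (2 * j * P - x - 2))"

lemma reflected_walks_Suc:
  "reflected_walks P J (Suc k) x = reflected_walks P J k (x - 1) + reflected_walks P J k (x + 1)"
  unfolding reflected_walks_def sum.distrib[symmetric]
  by (intro sum.cong) (auto simp: algebra_simps)

text \<open>The barrier at -1: the two terms of each summand coincide.\<close>

lemma reflected_walks_lower: "reflected_walks P J k (- 1) = 0"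
  by (simp add: reflected_walks_def)

lemma sum_int_telescope:
  fixes f :: "int \<Rightarrow> int"
  assumes "0 \<le> J"
  shows "(\<Sum>j\<in>{-J..J}. f j - f (j - 1)) = f J - f (- J - 1)"
proof -
  have "(\<Sum>j\<in>{-int K..int K}. f j - f (j - 1)) = f (int K) - f (- int K - 1)" for K
  proof (induction K)
    case (Suc K)
    have "{-int (Suc K)..int (Suc K)} = insert (int K + 1) (insert (- int K - 1) {-int K..int K})"
      by auto
    then show ?case
      using Suc by (simp add: algebra_simps)
  qed simp
  from this[of "nat J"] assms show ?thesis by simp
qed

text \<open>At this barrier the second term for \<open>j\<close> equals the first term for
  \<open>j - 1\<close>, so the sum telescopes. The two remaining end terms are out of reach of
  \<open>k \<le> J\<close> steps.\<close>

lemma reflected_walks_upper: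
  assumes "2 \<le> P" "int k \<le> J"
  shows "reflected_walks P J k (P - 1) = 0"
proof -
  have "reflected_walks P J k (P - 1) =
      (\<Sum>j\<in>{-J..J}. walks k (P - 1 + 2 * j * P) - walks k (P - 1 + 2 * (j - 1) * P))"
    unfolding reflected_walks_def by (intro sum.cong) (auto simp: algebra_simps)
  also have "\<dots> = walks k (P - 1 + 2 * J * P) - walks k (P - 1 + 2 * (- J - 1) * P)"
    using sum_int_telescope[of J "\<lambda>j. walks k (P - 1 + 2 * j * P)"] assms by simp
  also have "\<dots> = 0"
  proof -
    have "J \<le> J * P"
      using assms mult_left_mono[of 1 P J] by simp
    then show ?thesis
      using assms by (subst (1 2) walks_eq_0) (auto simp: algebra_simps)
  qed
  finally show ?thesis .
qed

text \<open>For nonzero \<open>j\<close> the images are shifted by at least \<open>2 * P\<close>,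
  too far to meet 0 while \<open>0 \<le> x \<le> P - 2\<close>; for \<open>j = 0\<close> the
  reflected image \<open>- x - 2\<close> is negative.\<close>

lemma reflected_walks_0:
  assumes "2 \<le> P" "0 \<le> J" "0 \<le> x" "x \<le> P - 2"
  shows "reflected_walks P J 0 x = (if x = 0 then 1 else 0)"
proof -
  have *: "x + 2 * j * P = 0 \<longleftrightarrow> j = 0 \<and> x = 0" "2 * j * P - x - 2 \<noteq> 0" for j
  proof -
    consider "j \<ge> 1" | "j = 0" | "j \<le> -1" by linarith
    then have "j * P \<ge> P \<or> j = 0 \<or> j * P \<le> - P"
    proof cases
      case 1
      then show ?thesis using assms mult_right_mono[of 1 j P] by simp
    next
      case 3
      then show ?thesis using assms mult_right_mono[of j "-1" P] by simp
    qed simp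
    moreover have "j = 0 \<Longrightarrow> j * P = 0" by simp
    moreover have "2 * j * P = 2 * (j * P)" by simp
    ultimately show "x + 2 * j * P = 0 \<longleftrightarrow> j = 0 \<and> x = 0" "2 * j * P - x - 2 \<noteq> 0"
      using assms by (smt (verit))+
  qed
  have "reflected_walks P J 0 x = (\<Sum>j\<in>{-J..J}. if j = 0 then (if x = 0 then 1 else 0) else 0)"
    unfolding reflected_walks_def using * by (intro sum.cong) auto
  then show ?thesis
    using assms by simp
qed

text \<open>When the upper barrier is out of reach, only \<open>j = 0\<close> contributes and the
  ballot difference remains.\<close>

lemma reflected_walks_single:
  assumes "0 \<le> J" "int k + 2 < P"
  shows "reflected_walks P J k 0 = walks k 0 - walks k 2"
proof -
  have "walks k (2 * j * P) - walks k (2 * j * P - 2) = (if j = 0 then walks k 0 - walks k 2 else 0)" for j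
  proof (cases "j = 0")
    case False
    then consider "j \<ge> 1" | "j \<le> -1" by linarith
    then have "j * P \<ge> P \<or> j * P \<le> - P"
    proof cases
      case 1
      then show ?thesis using assms mult_right_mono[of 1 j P] by simp
    next
      case 2
      then show ?thesis using assms mult_right_mono[of j "-1" P] by simp
    qed
    then have "int k < \<bar>2 * j * P\<bar>" "int k < \<bar>2 * j * P - 2\<bar>"
      using assms by linarith+
    then show ?thesis
      using False by (simp add: walks_eq_0)
  qed (use walks_minus[of k 2] in auto)
  then show ?thesis
    using assms by (simp add: reflected_walks_def)
qed

text \<open>Both sides obey the same recursion and agree at step 0. With \<open>P = B + 2\<close>
  the barriers are -1 and \<open>B + 1\<close>, just outside the allowed heights.\<close>

lemma (in extremal_enumeration) card_bounded_states:
  assumes "k \<le> N" "h \<le> B"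
  shows "int (card (bounded_states B k h)) = reflected_walks (int B + 2) (int N) k (int h)"
  using assms
proof (induction k arbitrary: h)
  case 0
  then show ?case
    by (subst reflected_walks_0) (auto simp: bounded_states_0)
next
  case (Suc k)
  let ?F = "reflected_walks (int B + 2) (int N) k"
  have down: "int (if h = 0 then 0 else card (bounded_states B k (h - 1))) = ?F (int h - 1)"
    using Suc.IH[of "h - 1"] Suc.prems reflected_walks_lower[of "int B + 2" "int N" k]
    by (auto simp: of_nat_diff)
  \<comment> \<open>For \<open>h = B\<close> the upper neighbour is on the barrier
    \<open>P - 1\<close>, where both sides vanish.\<close>
  have up: "int (card (bounded_states B k (Suc h))) = ?F (int h + 1)"
  proof (cases "h = B")
    case True
    then show ?thesis
      using reflected_walks_upper[of "int B + 2" k "int N"] Suc.prems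
      by (simp add: bounded_states_gt add.commute)
  next
    case False
    then show ?thesis
      using Suc.IH[of "Suc h"] Suc.prems by (simp add: algebra_simps)
  qed
  show ?case
    unfolding reflected_walks_Suc using card_bounded_states_Suc[of k h B] Suc.prems down up by simp
qed



section \<open>Catalan states\<close>

text \<open>The boundary cut open between \<open>Bottom 1\<close> and \<open>Lft m\<close> instead of at the top left corner, so
  that the points above a horizontal line form an interval.\<close>

definition position :: "nat \<Rightarrow> nat \<Rightarrow> point \<Rightarrow> int" where
  "position m n q = int (clockwise m n q) -
     (if clockwise m n q \<le> 2 * n + m then 0 else 2 * (int m + int n))"

definition zigzag :: "nat \<Rightarrow> nat \<Rightarrow> nat \<Rightarrow> point" where
  "zigzag m n k =
     (if k < n then Top (k + 1)
      else if k < n + 2 * m then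
        (if even (k - n) then Rgt ((k - n) div 2 + 1) else Lft ((k - n) div 2 + 1))
      else Bottom (2 * (m + n) - k))"

lemma zigzag_cases:
  assumes "k < 2 * (m + n)"
  obtains "k < n" "zigzag m n k = Top (k + 1)" "position m n (zigzag m n k) = int k + 1"
  | i where "i < m" "k = n + 2 * i" "zigzag m n k = Rgt (i + 1)"
      "position m n (zigzag m n k) = int n + int i + 1"
  | i where "i < m" "k = n + 2 * i + 1" "zigzag m n k = Lft (i + 1)"
      "position m n (zigzag m n k) = - int i"
  | "n + 2 * m \<le> k" "zigzag m n k = Bottom (2 * (m + n) - k)"
      "position m n (zigzag m n k) = int k - int m + 1"
proof -
  consider "k < n" | "n \<le> k" "k < n + 2 * m" "even (k - n)" | "n \<le> k" "k < n + 2 * m" "odd (k - n)"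
    | "n + 2 * m \<le> k"
    by linarith
  then show ?thesis
  proof cases
    case 1
    then show ?thesis by (intro that(1)) (auto simp: zigzag_def position_def)
  next
    case 2
    then obtain i where "k = n + 2 * i"
      by (metis evenE le_add_diff_inverse)
    with 2 show ?thesis by (intro that(2)[of i]) (auto simp: zigzag_def position_def)
  next
    case 3
    then obtain i where "k = n + (2 * i + 1)"
      by (metis oddE le_add_diff_inverse)
    with 3 show ?thesis by (intro that(3)[of i]) (auto simp: zigzag_def position_def)
  next
    case 4
    with assms show ?thesis by (intro that(4)) (auto simp: zigzag_def position_def)
  qed
qed

text \<open>Left points get positions below everything placed before them, all other points
  positions above it.\<close>

lemma extremal_zigzag:
  assumes "k < 2 * (m + n)"
  shows "extremal (position m n) (zigzag m n ` {..<k}) (zigzag m n k)"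
proof -
  have "position m n (zigzag m n j) < position m n (zigzag m n k)"
    if "j < k" "\<nexists>i. i < m \<and> k = n + 2 * i + 1" for j
  proof -
    have j: "j < 2 * (m + n)"
      using that assms by simp
    show ?thesis
      by (cases rule: zigzag_cases[OF assms]; cases rule: zigzag_cases[OF j]) (use that in auto)
  qed
  moreover have "position m n (zigzag m n k) < position m n (zigzag m n j)"
    if "j < k" "i < m" "k = n + 2 * i + 1" for i j
  proof -
    have j: "j < 2 * (m + n)"
      using that assms by simp
    show ?thesis
      by (cases rule: zigzag_cases[OF assms]; cases rule: zigzag_cases[OF j]) (use that in auto, presburger+)
  qed
  ultimately show ?thesis
    unfolding extremal_def by (cases "\<exists>i. i < m \<and> k = n + 2 * i + 1") blast+
qed

interpretation zigzag: extremal_enumeration "zigzag m n" "position m n" "2 * (m + n)" for m n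
  by standard (rule extremal_zigzag)

lemma zigzag_prefix:
  assumes "i \<le> m"
  shows "zigzag m n ` {..<n + 2 * i} = {q \<in> marked_points m n. above_line i q}"
proof
  show "zigzag m n ` {..<n + 2 * i} \<subseteq> {q \<in> marked_points m n. above_line i q}"
  proof (rule image_subsetI)
    fix k assume k: "k \<in> {..<n + 2 * i}"
    with assms have "k < 2 * (m + n)" by simp
    then show "zigzag m n k \<in> {q \<in> marked_points m n. above_line i q}"
      using k assms by (cases k m n rule: zigzag_cases) (auto simp: marked_points_def)
  qed
  show "{q \<in> marked_points m n. above_line i q} \<subseteq> zigzag m n ` {..<n + 2 * i}"
  proof
    fix q assume "q \<in> {q \<in> marked_points m n. above_line i q}"
    then consider j where "q = Top j" "1 \<le> j" "j \<le> n"
      | j where "q = Rgt j" "1 \<le> j" "j \<le> i" | j where "q = Lft j" "1 \<le> j" "j \<le> i"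
      by (auto simp: marked_points_def)
    then show "q \<in> zigzag m n ` {..<n + 2 * i}"
    proof cases
      case 1
      then show ?thesis by (intro image_eqI[of _ _ "j - 1"]) (auto simp: zigzag_def)
    next
      case 2
      then show ?thesis
        using assms by (intro image_eqI[of _ _ "n + 2 * (j - 1)"]) (auto simp: zigzag_def)
    next
      case 3
      then show ?thesis
        using assms by (intro image_eqI[of _ _ "n + 2 * (j - 1) + 1"]) (auto simp: zigzag_def)
    qed
  qed
qed

lemma card_marked_points: "card (marked_points m n) = 2 * (m + n)"
  using bij_betw_same_card[OF bij_betw_clockwise, of m n] by simp

lemma zigzag_all: "zigzag m n ` {..<2 * (m + n)} = marked_points m n"
proof (rule card_subset_eq)
  show "finite (marked_points m n)"
    by (simp add: marked_points_def)
  show "zigzag m n ` {..<2 * (m + n)} \<subseteq> marked_points m n"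
  proof (rule image_subsetI)
    fix k assume "k \<in> {..<2 * (m + n)}"
    then have k: "k < 2 * (m + n)" by simp
    show "zigzag m n k \<in> marked_points m n"
      by (cases rule: zigzag_cases[OF k]) (use k in \<open>auto simp: marked_points_def image_iff\<close>)
  qed
  show "card (zigzag m n ` {..<2 * (m + n)}) = card (marked_points m n)"
    using zigzag.card_S[of "2 * (m + n)" m n] by (simp add: card_marked_points)
qed

section \<open>Noncrossing perfect matchings and the choice of the cut\<close>

lemma perfect_matching_iff:
  "perfect_matching A C \<longleftrightarrow> (\<forall>a\<in>C. a \<subseteq> A \<and> card a = 2) \<and> disjoint C \<and> A \<subseteq> \<Union>C"
  unfolding perfect_matching_def partition_on_def by fastforce

text \<open>Here every point has exactly one partner, so the existential over \<open>w\<close>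
  becomes a statement about that partner.\<close>

lemma partial_noncrossing_perfect:
  assumes "perfect_matching A C"
  shows "partial_noncrossing key A C \<longleftrightarrow>
    (\<forall>a b r s. {a, b} \<in> C \<longrightarrow> {r, s} \<in> C \<longrightarrow> btw (key a) (key r) (key b) \<longrightarrow> btw (key a) (key s) (key b))"
proof -
  have pairs: "\<forall>a\<in>C. a \<subseteq> A \<and> card a = 2" and disj: "disjoint C" and cover: "A \<subseteq> \<Union>C"
    using assms by (simp_all add: perfect_matching_iff)
  have ex: "\<exists>s. {r, s} \<in> C" if "r \<in> A" for r
    using that cover pairs by (metis UnionE card_2_memE insert_commute subset_iff)
  have uniq: "s = t" if "{r, s} \<in> C" "{r, t} \<in> C" for r s t
    using disjointD_mem[OF disj that, of r] by (auto simp: doubleton_eq_iff)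
  have "(\<forall>a b z. {a, b} \<in> C \<longrightarrow> z \<in> A \<longrightarrow> btw (key a) (key z) (key b) \<longrightarrow>
        (\<exists>w. {z, w} \<in> C \<and> btw (key a) (key w) (key b))) \<longleftrightarrow>
      (\<forall>a b r s. {a, b} \<in> C \<longrightarrow> {r, s} \<in> C \<longrightarrow> btw (key a) (key r) (key b) \<longrightarrow> btw (key a) (key s) (key b))"
    (is "?l \<longleftrightarrow> ?r")
  proof
    assume l: ?l
    show ?r
    proof (intro allI impI)
      fix a b r s
      assume arcs: "{a, b} \<in> C" "{r, s} \<in> C" and "btw (key a) (key r) (key b)"
      moreover have "r \<in> A"
        using arcs pairs by blast
      ultimately obtain w where "{r, w} \<in> C" "btw (key a) (key w) (key b)"
        using l by meson
      then show "btw (key a) (key s) (key b)"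
        using uniq arcs by metis
    qed
  next
    assume ?r
    then show ?l
      using ex by meson
  qed
  then show ?thesis
    using pairs disj unfolding partial_noncrossing_def by blast
qed

lemma clockwise_inj: "p \<in> marked_points m n \<Longrightarrow> q \<in> marked_points m n \<Longrightarrow>
    clockwise m n p = clockwise m n q \<Longrightarrow> p = q"
  using bij_betw_clockwise[of m n] by (auto simp: bij_betw_def inj_on_def)

lemma clockwise_range: "p \<in> marked_points m n \<Longrightarrow> 1 \<le> clockwise m n p \<and> clockwise m n p \<le> 2 * (m + n)"
  using bij_betw_clockwise[of m n] by (auto simp: bij_betw_def)

lemma noncrossing_iff:
  assumes C: "perfect_matching (marked_points m n) C"
  shows "noncrossing m n C \<longleftrightarrow> partial_noncrossing (clockwise m n) (marked_points m n) C"
proof -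
  have pairs: "\<forall>a\<in>C. a \<subseteq> marked_points m n \<and> card a = 2" and disj: "disjoint C"
    using C by (simp_all add: perfect_matching_iff)
  let ?f = "clockwise m n"
  have "btw (?f a) (?f s) (?f b)"
    if nc: "noncrossing m n C" and arcs: "{a, b} \<in> C" "{r, s} \<in> C" and r: "btw (?f a) (?f r) (?f b)" for a b r s
  proof -
    have nc': "\<not> (?f p < ?f r \<and> ?f r < ?f q \<and> ?f q < ?f s)" if "{p, q} \<in> C" "{r, s} \<in> C" for p q r s
      using nc that unfolding noncrossing_def by blast
    have "r \<noteq> a" "r \<noteq> b"
      using r by (auto simp: btw_def)
    then have "s \<noteq> a" "s \<noteq> b"
      using disjointD_mem[OF disj arcs, of s] by auto
    then have "?f s \<noteq> ?f a" "?f s \<noteq> ?f b"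
      using clockwise_inj[of s m n] arcs pairs by blast+
    \<comment> \<open>\<open>noncrossing\<close> forbids one ordered pattern. The order of
      \<open>a\<close> and \<open>b\<close> and the side on which \<open>s\<close> would lie give
      four cases, each an instance after swapping names.\<close>
    moreover have "{b, a} \<in> C" "{s, r} \<in> C"
      using arcs by (simp_all add: insert_commute)
    ultimately show ?thesis
      using r nc'[OF arcs] nc'[of b a r s] nc'[of s r a b] nc'[of s r b a] arcs
      unfolding btw_def by linarith
  qed
  moreover have "noncrossing m n C"
    if btw: "\<And>a b r s. {a, b} \<in> C \<Longrightarrow> {r, s} \<in> C \<Longrightarrow> btw (?f a) (?f r) (?f b) \<Longrightarrow> btw (?f a) (?f s) (?f b)"
    unfolding noncrossing_def
  proof (intro notI, elim exE conjE)
    fix p q r s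
    assume "{p, q} \<in> C" "{r, s} \<in> C" "?f p < ?f r" "?f r < ?f q" "?f q < ?f s"
    with btw[of p q r s] show False
      unfolding btw_def by linarith
  qed
  ultimately show ?thesis
    unfolding partial_noncrossing_perfect[OF C] by blast
qed

text \<open>Cutting the boundary elsewhere exchanges the inside and the outside of exactly those arcs
  whose endpoints are separated by the cut.\<close>

lemma btw_position:
  assumes "a \<in> marked_points m n" "b \<in> marked_points m n" "r \<in> marked_points m n" "r \<noteq> a" "r \<noteq> b"
  shows "btw (position m n a) (position m n r) (position m n b) \<longleftrightarrow>
    (btw (clockwise m n a) (clockwise m n r) (clockwise m n b) \<longleftrightarrow>
      (clockwise m n a \<le> 2 * n + m \<longleftrightarrow> clockwise m n b \<le> 2 * n + m))"
proof -
  have "clockwise m n r \<noteq> clockwise m n a" "clockwise m n r \<noteq> clockwise m n b"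
    using assms clockwise_inj by blast+
  then show ?thesis
    using clockwise_range[OF assms(1)] clockwise_range[OF assms(2)] clockwise_range[OF assms(3)]
    unfolding position_def btw_def
    by (cases "clockwise m n a \<le> 2 * n + m"; cases "clockwise m n b \<le> 2 * n + m";
        cases "clockwise m n r \<le> 2 * n + m") auto
qed

text \<open>Whether the cut exchanges the sides of \<open>{a, b}\<close> depends on \<open>a\<close>
  and \<open>b\<close> only, so it affects both endpoints of another arc alike.\<close>

lemma partial_noncrossing_position:
  assumes C: "perfect_matching (marked_points m n) C"
  shows "partial_noncrossing (position m n) (marked_points m n) C \<longleftrightarrow>
    partial_noncrossing (clockwise m n) (marked_points m n) C"
proof -
  have pairs: "\<forall>a\<in>C. a \<subseteq> marked_points m n \<and> card a = 2" and disj: "disjoint C"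
    using C by (simp_all add: perfect_matching_iff)
  \<comment> \<open>Symmetric form: both endpoints of any other arc lie on the same side of
    \<open>{a, b}\<close>.\<close>
  have sym: "partial_noncrossing key (marked_points m n) C \<longleftrightarrow>
      (\<forall>a b r s. {a, b} \<in> C \<longrightarrow> {r, s} \<in> C \<longrightarrow> {a, b} \<noteq> {r, s} \<longrightarrow>
        (btw (key a) (key r) (key b) \<longleftrightarrow> btw (key a) (key s) (key b)))"
    for key :: "point \<Rightarrow> 'b::linorder"
  proof -
    have "{a, b} \<noteq> {r, s}" if "btw (key a) (key r) (key b)" for a b r s
      using that by (auto simp: btw_def doubleton_eq_iff)
    moreover have "{s, r} \<in> C" if "{r, s} \<in> C" for r s
      using that by (simp add: insert_commute)
    ultimately show ?thesis
      unfolding partial_noncrossing_perfect[OF C] by (intro iffI allI impI) blast+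
  qed
  have "btw (position m n a) (position m n r) (position m n b) =
        btw (position m n a) (position m n s) (position m n b) \<longleftrightarrow>
      btw (clockwise m n a) (clockwise m n r) (clockwise m n b) =
        btw (clockwise m n a) (clockwise m n s) (clockwise m n b)"
    if "{a, b} \<in> C" "{r, s} \<in> C" "{a, b} \<noteq> {r, s}" for a b r s
  proof -
    have "r \<noteq> a" "r \<noteq> b" "s \<noteq> a" "s \<noteq> b"
      using disjointD_mem[OF disj that(1,2)] that(3) by auto
    moreover have "a \<in> marked_points m n" "b \<in> marked_points m n" "r \<in> marked_points m n"
        "s \<in> marked_points m n"
      using pairs that by blast+
    ultimately show ?thesis
      using btw_position[of a m n b r] btw_position[of a m n b s] by blast
  qed
  then show ?thesis
    unfolding sym by meson
qed

lemma catalan_states_eq: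
  "catalan_states m n = {C. partial_noncrossing (position m n) (marked_points m n) C \<and>
     defect (marked_points m n) C = 0}"
proof -
  have "perfect_matching (marked_points m n) C \<longleftrightarrow>
      (\<forall>a\<in>C. a \<subseteq> marked_points m n \<and> card a = 2) \<and> disjoint C \<and> defect (marked_points m n) C = 0" for C
  proof -
    have "inner_arcs (marked_points m n) C = C" if "\<forall>a\<in>C. a \<subseteq> marked_points m n \<and> card a = 2"
      using that by (auto simp: inner_arcs_def)
    moreover have "finite (marked_points m n)"
      by (simp add: marked_points_def)
    ultimately show ?thesis
      unfolding perfect_matching_iff defect_def
      by (cases "\<forall>a\<in>C. a \<subseteq> marked_points m n \<and> card a = 2") (simp_all only: card_eq_0_iff finite_Diff Diff_eq_empty_iff simp_thms)
  qed
  then have "C \<in> catalan_states m n \<longleftrightarrow> partial_noncrossing (position m n) (marked_points m n) C \<and>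
      defect (marked_points m n) C = 0" for C
    using noncrossing_iff[of m n C] partial_noncrossing_position[of m n C]
    unfolding catalan_states_def mem_Collect_eq by (metis partial_noncrossing_def)
  then show ?thesis by blast
qed

section \<open>Line crossings as heights\<close>

text \<open>In a perfect matching each arc leaving \<open>S\<close> contributes exactly one
  unmatched point, its endpoint in \<open>S\<close>.\<close>

lemma defect_eq_card_crossing:
  assumes "perfect_matching A C" "S \<subseteq> A" "finite A"
  shows "defect S C = card {a \<in> C. a \<inter> S \<noteq> {} \<and> \<not> a \<subseteq> S}"
proof -
  let ?X = "{a \<in> C. a \<inter> S \<noteq> {} \<and> \<not> a \<subseteq> S}"
  have pairs: "\<forall>a\<in>C. a \<subseteq> A \<and> card a = 2" and disj: "disjoint C" and cover: "A \<subseteq> \<Union>C"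
    using assms by (simp_all add: perfect_matching_iff)
  have "S - \<Union>(inner_arcs S C) = (\<Union>a\<in>?X. a \<inter> S)"
  proof (intro equalityI subsetI)
    fix x assume x: "x \<in> S - \<Union>(inner_arcs S C)"
    then obtain a where "a \<in> C" "x \<in> a"
      using cover assms(2) by blast
    then show "x \<in> (\<Union>a\<in>?X. a \<inter> S)"
      using x unfolding inner_arcs_def by blast
  next
    fix x assume "x \<in> (\<Union>a\<in>?X. a \<inter> S)"
    then obtain a where a: "a \<in> C" "\<not> a \<subseteq> S" "x \<in> a" "x \<in> S"
      by blast
    have "b = a" if "b \<in> C" "x \<in> b" for b
      using disjointD_mem[OF disj that(1) a(1) that(2) a(3)] .
    then show "x \<in> S - \<Union>(inner_arcs S C)"
      using a unfolding inner_arcs_def by blast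
  qed
  also have "card \<dots> = (\<Sum>a\<in>?X. card (a \<inter> S))"
  proof (rule card_UN_disjoint)
    show "finite ?X"
      using assms(3) pairs by (intro finite_subset[of ?X "Pow A"]) auto
    show "\<forall>a\<in>?X. finite (a \<inter> S)"
      using assms(2,3) finite_subset by blast
    show "\<forall>a\<in>?X. \<forall>b\<in>?X. a \<noteq> b \<longrightarrow> (a \<inter> S) \<inter> (b \<inter> S) = {}"
      using disjointD[OF disj] by blast
  qed
  also have "\<dots> = (\<Sum>a\<in>?X. 1)"
  proof (rule sum.cong)
    fix a assume a: "a \<in> ?X"
    then obtain u v where uv: "a = {u, v}" "u \<noteq> v"
      using pairs by (metis (mono_tags, lifting) card_2_iff mem_Collect_eq)
    with a have "a \<inter> S = {u} \<or> a \<inter> S = {v}"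
      by auto
    then show "card (a \<inter> S) = 1"
      by auto
  qed simp
  finally show ?thesis
    by (simp add: defect_def)
qed

lemma line_crossings_eq_defect:
  assumes "C \<in> catalan_states m n" "i \<le> m"
  shows "line_crossings i C = defect (zigzag m n ` {..<n + 2 * i}) C"
proof -
  have C: "perfect_matching (marked_points m n) C"
    using assms(1) by (simp add: catalan_states_def)
  then have sub: "\<forall>a\<in>C. a \<subseteq> marked_points m n"
    by (simp add: perfect_matching_iff)
  have "defect (zigzag m n ` {..<n + 2 * i}) C =
      card {a \<in> C. a \<inter> {q \<in> marked_points m n. above_line i q} \<noteq> {} \<and>
        \<not> a \<subseteq> {q \<in> marked_points m n. above_line i q}}"
    unfolding zigzag_prefix[OF assms(2)]
    by (rule defect_eq_card_crossing[OF C]) (auto simp: marked_points_def)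
  also have "{a \<in> C. a \<inter> {q \<in> marked_points m n. above_line i q} \<noteq> {} \<and>
        \<not> a \<subseteq> {q \<in> marked_points m n. above_line i q}} =
      {a \<in> C. \<exists>p\<in>a. \<exists>q\<in>a. above_line i p \<and> \<not> above_line i q}"
    using sub by blast
  finally show ?thesis
    by (simp add: line_crossings_def)
qed

text \<open>The height of the path is even or odd with the step and at most \<open>n\<close> in the first and the last
  \<open>n\<close> steps, so it exceeds \<open>n + 1\<close> only if it exceeds \<open>n\<close> at some horizontal line.\<close>

lemma horizontally_excluded_iff:
  assumes C: "C \<in> catalan_states m n"
  shows "horizontally_excluded m n C \<longleftrightarrow>
    (\<exists>k\<le>2 * (m + n). n + 1 < defect (zigzag m n ` {..<k}) C)"
proof -
  define d where "d k = defect (zigzag m n ` {..<k}) C" for k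
  have pn: "partial_noncrossing (position m n) (marked_points m n) C" and d0: "defect (marked_points m n) C = 0"
    using C by (simp_all only: catalan_states_eq mem_Collect_eq)
  have pairs: "\<forall>a\<in>C. card a = 2" and disj: "disjoint C"
    using pn by (simp_all add: partial_noncrossing_def)
  have d_end: "d (2 * (m + n)) = 0"
    by (simp only: d_def zigzag_all d0)
  have parity: "even (d k) \<longleftrightarrow> even k" and d_le: "d k \<le> k" and d_le': "d k \<le> 2 * (m + n) - k"
    if k: "k \<le> 2 * (m + n)" for k
  proof -
    have "d k + 2 * card (inner_arcs (zigzag m n ` {..<k}) C) = k"
      unfolding d_def using defect_plus_arcs[OF _ pairs disj, of "zigzag m n ` {..<k}"] zigzag.card_S[OF k]
      by simp
    then show "even (d k) \<longleftrightarrow> even k" "d k \<le> k" by presburger+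
    show "d k \<le> 2 * (m + n) - k"
      using zigzag.defect_diff[OF k order_refl pairs disj] d_end by (simp add: d_def)
  qed
  have lc: "line_crossings i C = d (n + 2 * i)" if "i \<le> m" for i
    using line_crossings_eq_defect[OF C that] by (simp add: d_def)
  have "horizontally_excluded m n C \<longleftrightarrow> (\<exists>i\<in>{1..m - 1}. n < d (n + 2 * i))"
  proof (cases "m \<le> 1")
    case True
    then show ?thesis by (auto simp: horizontally_excluded_def d_h_def)
  next
    case False
    then have "horizontally_excluded m n C \<longleftrightarrow> (\<exists>i\<in>{1..m - 1}. n < line_crossings i C)"
      unfolding horizontally_excluded_def d_h_def by (simp add: Max_gr_iff)
    then show ?thesis
      using lc by (metis atLeastAtMost_iff diff_le_self order_trans)
  qed
  also have "\<dots> \<longleftrightarrow> (\<exists>k\<le>2 * (m + n). n + 1 < d k)"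
  proof
    assume "\<exists>i\<in>{1..m - 1}. n < d (n + 2 * i)"
    then obtain i where i: "1 \<le> i" "i \<le> m - 1" "n < d (n + 2 * i)" by auto
    then have "n + 2 * i \<le> 2 * (m + n)"
      by arith
    \<comment> \<open>At a line the height has the parity of \<open>n\<close>, so exceeding
      \<open>n\<close> means at least \<open>n + 2\<close>.\<close>
    then have "d (n + 2 * i) \<noteq> n + 1"
      using parity[of "n + 2 * i"] by auto
    with i show "\<exists>k\<le>2 * (m + n). n + 1 < d k"
      by (intro exI[of _ "n + 2 * i"]) auto
  next
    assume "\<exists>k\<le>2 * (m + n). n + 1 < d k"
    then obtain k where k: "k \<le> 2 * (m + n)" "n + 1 < d k" by blast
    then have bounds: "n + 1 < k" "n + 1 < 2 * (m + n) - k"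
      using d_le[of k] d_le'[of k] by simp_all
    show "\<exists>i\<in>{1..m - 1}. n < d (n + 2 * i)"
    proof (cases "even (k - n)")
      case True
      then obtain i where "k = n + 2 * i"
        using bounds by (metis evenE le_add_diff_inverse add_lessD1 less_imp_le)
      with bounds k show ?thesis
        by (intro bexI[of _ i]) auto
    next
      \<comment> \<open>Between two lines the parity is opposite, so the height is at least
        \<open>n + 3\<close>, and one step earlier, at a line, at least
        \<open>n + 2\<close>.\<close>
      case False
      then obtain i where "k - n = 2 * i + 1"
        by (elim oddE)
      then have i: "k = n + 2 * i + 1"
        using bounds by linarith
      then have "d k \<noteq> n + 2"
        using parity[OF k(1)] by auto
      then have "n + 2 < d k"
        using k by linarith
      moreover have "d k \<le> d (n + 2 * i) + 1"
        using zigzag.defect_Suc(1)[of "n + 2 * i" m n C] pairs disj k i by (simp add: d_def)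
      ultimately show ?thesis
        using bounds i by (intro bexI[of _ i]) auto
    qed
  qed
  finally show ?thesis
    by (simp add: d_def)
qed

section \<open>The count by complement and its binomial form\<close>

lemma T_h_eq_reflected_walks:
  fixes m n :: nat
  defines "N \<equiv> 2 * (m + n)"
  shows "int (T_h m n) = walks N 0 - walks N 2 - reflected_walks (int n + 3) (int N) N 0"
proof -
  \<comment> \<open>Heights never exceed \<open>N\<close>, so the bound \<open>N + 1\<close>
    restricts nothing; it gives \<open>P = N + 3\<close>, large enough for
    \<open>reflected_walks_single\<close>.\<close>
  let ?All = "zigzag.bounded_states m n (N + 1) N 0" and ?Low = "zigzag.bounded_states m n (n + 1) N 0"
  have le: "defect (zigzag m n ` {..<k}) C \<le> N + 1" if "k \<le> N" for k C
  proof -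
    have "defect (zigzag m n ` {..<k}) C \<le> card (zigzag m n ` {..<k})"
      unfolding defect_def by (intro card_mono) auto
    also have "\<dots> \<le> k"
      using card_image_le[of "{..<k}" "zigzag m n"] by simp
    finally show ?thesis using that by simp
  qed
  have all: "zigzag m n ` {..<N} = marked_points m n"
    by (simp only: N_def zigzag_all)
  have All: "catalan_states m n = ?All"
    unfolding catalan_states_eq zigzag.bounded_states_def all using le by blast
  have Low: "C \<in> ?Low \<longleftrightarrow> C \<in> catalan_states m n \<and> \<not> horizontally_excluded m n C" for C
    using horizontally_excluded_iff[of C m n]
    unfolding N_def[symmetric] catalan_states_eq zigzag.bounded_states_def all mem_Collect_eq not_less[symmetric]
    by blast
  have "{C \<in> catalan_states m n. horizontally_excluded m n C} = ?All - ?Low"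
    using Low All by blast
  moreover have "?Low \<subseteq> ?All"
    using Low All by blast
  ultimately have "int (T_h m n) = int (card ?All) - int (card ?Low)"
    unfolding T_h_def
    by (simp add: card_Diff_subset zigzag.finite_bounded_states card_mono of_nat_diff)
  also have "int (card ?All) = walks N 0 - walks N 2"
    using zigzag.card_bounded_states[of N m n 0 "N + 1"] reflected_walks_single[of "int N" N "int (N + 1) + 2"]
    by (simp add: N_def)
  also have "int (card ?Low) = reflected_walks (int n + 3) (int N) N 0"
    using zigzag.card_bounded_states[of N m n 0 "n + 1"] by (simp add: N_def algebra_simps)
  finally show ?thesis .
qed

lemma sum_int_symmetric:
  fixes f :: "int \<Rightarrow> int"
  shows "(\<Sum>j\<in>{-int K..int K}. f j) = f 0 + (\<Sum>i<K. f (int i + 1) + f (- int i - 1))"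
proof (induction K)
  case (Suc K)
  have "{-int (Suc K)..int (Suc K)} = insert (int K + 1) (insert (- int K - 1) {-int K..int K})"
    by auto
  then show ?case
    using Suc by (simp add: algebra_simps)
qed simp

theorem theorem4p6:
  fixes m n :: nat
  assumes "m \<ge> 1" and "n \<ge> 1"
  shows "(\<lambda>i::nat.
            binom (2 * m + 2 * n) (int m - int i * (int n + 3) - 2)
            - 2 * binom (2 * m + 2 * n) (int m - int i * (int n + 3) - 3)
            + binom (2 * m + 2 * n) (int m - int i * (int n + 3) - 4))
         sums int (T_h m n)"
proof -
  define N where "N = 2 * m + 2 * n"
  define P where "P = int n + 3"
  define g where "g i = binom N (int m - int i * P - 2) - 2 * binom N (int m - int i * P - 3)
      + binom N (int m - int i * P - 4)" for i
  \<comment> \<open>The terms \<open>0 +\<close> and \<open>- 0\<close> keep the shape of the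
    summand of \<open>reflected_walks\<close> at \<open>x = 0\<close>.\<close>
  define f where "f j = walks N (0 + 2 * j * P) - walks N (2 * j * P - 0 - 2)" for j
  have walks_even: "walks N (2 * y) = binom N (int m + int n - y)" for y
    using walks_eq_binom[of N "int m + int n - y"] walks_minus[of N "2 * y"]
    by (simp add: N_def algebra_simps)
  \<comment> \<open>The indices \<open>i + 1\<close> and \<open>- i - 1\<close> share the distance
    \<open>2 * ?y\<close> by symmetry, whence the coefficient 2. The offsets 2, 3, 4 come from
    \<open>n - P = - 3\<close>.\<close>
  have pair: "f (int i + 1) + f (- int i - 1) = - g i" for i
  proof -
    let ?y = "(int i + 1) * P"
    have "f (int i + 1) = walks N (2 * ?y) - walks N (2 * (?y - 1))"
      by (simp add: f_def algebra_simps)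
    moreover have "2 * (- int i - 1) * P = - (2 * ?y)" "- (2 * ?y) - 0 - 2 = - (2 * (?y + 1))"
      by (simp_all add: algebra_simps)
    then have "f (- int i - 1) = walks N (2 * ?y) - walks N (2 * (?y + 1))"
      by (simp only: f_def add_0 walks_minus)
    moreover have "int m + int n - ?y = int m - int i * P - 3"
        "int m + int n - (?y - 1) = int m - int i * P - 2"
        "int m + int n - (?y + 1) = int m - int i * P - 4"
      by (simp_all add: P_def algebra_simps)
    ultimately show ?thesis
      by (simp only: walks_even g_def)
  qed
  have "reflected_walks P (int N) N 0 = f 0 + (\<Sum>i<N. f (int i + 1) + f (- int i - 1))"
    unfolding reflected_walks_def f_def[symmetric] by (rule sum_int_symmetric)
  \<comment> \<open>The central term is the number of all states and cancels in the
    complement.\<close>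
  also have "f 0 = walks N 0 - walks N 2"
    using walks_minus[of N 2] by (simp add: f_def)
  finally have "int (T_h m n) = (\<Sum>i<N. g i)"
    using T_h_eq_reflected_walks[of m n] unfolding pair by (simp add: N_def P_def sum_negf)
  \<comment> \<open>From \<open>i = N\<close> on all lower indices are negative, so the series is a
    finite sum.\<close>
  moreover have "g i = 0" if "i \<notin> {..<N}" for i
  proof -
    have "int i * 1 \<le> int i * P"
      by (intro mult_left_mono) (simp_all add: P_def)
    then have "int m - int i * P \<le> 0"
      using that by (simp add: N_def)
    then show ?thesis
      by (simp add: g_def binom_def)
  qed
  ultimately have "g sums int (T_h m n)"
    using sums_finite[of "{..<N}" g] by simp
  then show ?thesis
    unfolding g_def[abs_def] N_def P_def .
qed

end
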